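(* For all integers $n \geq 1$ and all real $x$, $$-\frac{B_{n}(x)}{n} = \sum_{m=1}^n \frac{c_{m}(x)}{m} \genfrac{\{}{\}}{0pt}{}{n-1}{m-1}_x$$ and $$\frac{(-1)^{n}- B_{n}(x)}{n} = \sum_{m=1}^n \frac{\widehat{c}_{m}(-x)}{m}\genfrac{\{}{\}}{0pt}{}{n-1}{m-1}_x.$$
   Context: For real $z$ and integer $n\ge 0$, $\binom{z}{n} = \frac{z(z-1)\cdots(z-n+1)}{n!}$. The Cauchy polynomials of the first and second kind are $c_n(x) = n! \int_{0}^{1} \binom{t - x}{n}\, dt$ and $\widehat{c}_n(x) = n! \int_{0}^{1} \binom{x - t}{n}\, dt$, $n \ge 0$. $B_n(x)$ are the classical Bernoulli polynomials, $\frac{te^{xt}}{e^t-1}=\sum_{n\ge0}B_n(x)\frac{t^n}{n!}$. The generalized Stirling numbers of the second kind are $\genfrac{\{}{\}}{0pt}{}{n}{m}_x = \sum_{i=0}^{n-m} \binom{n}{i}\genfrac{\{}{\}}{0pt}{}{n-i}{m} x^i$ for $0 \leq m \leq n$ and $x\in\mathbb{R}$, where $\genfrac{\{}{\}}{0pt}{}{n}{m}$ are the ordinary Stirling numbers of the second kind and $x^0=1$. *)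

theory Defs
  imports "HOL-Analysis.Analysis" "HOL-Combinatorics.Stirling"
begin

definition cauchy_poly1 :: "nat \<Rightarrow> real \<Rightarrow> real" where
  "cauchy_poly1 n x = fact n * integral {0..1} (\<lambda>t::real. (t - x) gchoose n)"

definition cauchy_poly2 :: "nat \<Rightarrow> real \<Rightarrow> real" where
  "cauchy_poly2 n x = fact n * integral {0..1} (\<lambda>t::real. (x - t) gchoose n)"

text \<open>
  The coefficients of the exponential generating function \<open>t * exp (x * t) / (exp t - 1)\<close>,
  taken as a formal power series in \<open>t\<close>. The denominator is not a unit, but it has subdegree 1,
  so the division of formal power series is exact; see \<open>bernoulli_poly_egf\<close>.
\<close>

definition bernoulli_poly :: "nat \<Rightarrow> real \<Rightarrow> real" where
  "bernoulli_poly n x = fact n * fps_nth (fps_X * fps_exp x / (fps_exp 1 - 1)) n"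

lemma bernoulli_poly_egf:
  "Abs_fps (\<lambda>n. bernoulli_poly n x / fact n) * (fps_exp 1 - 1) = fps_X * fps_exp x"
proof -
  let ?g = "fps_exp 1 - 1 :: real fps"
  have g: "subdegree ?g = 1" by (rule subdegreeI) auto
  have nz: "?g \<noteq> 0" using g by auto
  have "subdegree (fps_X * fps_exp x) = 1"
    by (rule subdegreeI) (auto simp: fps_X_mult_nth)
  moreover have "fps_X * fps_exp x \<noteq> 0" by simp
  ultimately have "?g dvd fps_X * fps_exp x"
    using g nz by (simp add: fps_dvd_iff)
  moreover have "Abs_fps (\<lambda>n. bernoulli_poly n x / fact n) = fps_X * fps_exp x / ?g"
    by (rule fps_ext) (simp add: bernoulli_poly_def)
  ultimately show ?thesis by simp
qed

text \<open>Meant for \<open>m \<le> n\<close>; note that \<open>x ^ 0 = 1\<close> also for \<open>x = 0\<close>.\<close>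

definition gen_Stirling2 :: "nat \<Rightarrow> nat \<Rightarrow> real \<Rightarrow> real" where
  "gen_Stirling2 n m x = (\<Sum>i=0..n - m. real (n choose i) * real (Stirling (n - i) m) * x ^ i)"

end

theory Submission
  imports Defs
begin

text \<open>
  Put \<open>P z = (\<Sum>m=1..n. (z)\<^sub>m / m * S (n-1) (m-1) x)\<close>, where \<open>(z)\<^sub>m\<close> is the falling factorial and
  \<open>S\<close> the generalized Stirling numbers. Its forward difference is
  \<open>(\<Sum>m=1..n. (z)\<^sub>m\<^sub>-\<^sub>1 * S (n-1) (m-1) x) = (z + x) ^ (n-1)\<close>, the same as that of
  \<open>B\<^sub>n (z + x) / n\<close>; both are polynomials in \<open>z\<close> and \<open>P 0 = 0\<close>, so
  \<open>P z = (B\<^sub>n (z + x) - B\<^sub>n x) / n\<close>. The right-hand sides of the theorem are the integrals of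
  \<open>P (t - x)\<close> and of \<open>P (- x - t)\<close> over \<open>t \<in> [0, 1]\<close>, and \<open>B\<^sub>n\<close> has integral \<open>0\<close> over \<open>[0, 1]\<close>
  and \<open>(-1)\<^sup>n\<close> over \<open>[-1, 0]\<close>.
\<close>

text \<open>Multiplying by \<open>y\<close> sends the falling factorial \<open>(y)\<^sub>m\<close>
  to \<open>(y)\<^sub>m\<^sub>+\<^sub>1 + m * (y)\<^sub>m\<close>, which is the recurrence of the
  Stirling numbers read on coefficients.\<close>

lemma Stirling_sum_gbinomial:
  fixes y :: "'a :: field_char_0"
  shows "(\<Sum>m\<le>n. of_nat (Stirling n m) * fact m * (y gchoose m)) = y ^ n"
proof (induction n)
  case 0
  show ?case by simp
next
  case (Suc n)
  let ?f = "\<lambda>m. fact m * (y gchoose m)"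
  have step: "y * ?f m = ?f (Suc m) + of_nat m * ?f m" for m
    by (subst mult.left_commute, subst gbinomial_mult_1) (simp add: algebra_simps)
  have "y ^ Suc n = (\<Sum>m\<le>n. of_nat (Stirling n m) * (y * ?f m))"
    by (simp add: Suc.IH [symmetric] sum_distrib_left algebra_simps)
  also have "\<dots> = (\<Sum>m\<le>n. of_nat (Stirling n m) * ?f (Suc m))
                + (\<Sum>m\<le>n. of_nat m * of_nat (Stirling n m) * ?f m)"
    by (simp only: step ring_distribs sum.distrib) (simp add: algebra_simps)
  \<comment> \<open>The added top term is zero because \<open>Stirling n (Suc n) = 0\<close>; the
    shift that follows loses only the term \<open>m = 0\<close>, killed by its factor
    \<open>of_nat m\<close>.\<close>
  also have "(\<Sum>m\<le>n. of_nat m * of_nat (Stirling n m) * ?f m)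
               = (\<Sum>m\<le>Suc n. of_nat m * of_nat (Stirling n m) * ?f m)"
    by simp
  also have "\<dots> = (\<Sum>m\<le>n. of_nat (Suc m) * of_nat (Stirling n (Suc m)) * ?f (Suc m))"
    by (subst sum.atMost_Suc_shift) simp
  also have "(\<Sum>m\<le>n. of_nat (Stirling n m) * ?f (Suc m)) + \<dots>
               = (\<Sum>m\<le>n. of_nat (Stirling (Suc n) (Suc m)) * ?f (Suc m))"
    unfolding sum.distrib [symmetric] by (intro sum.cong) (simp_all add: algebra_simps)
  also have "\<dots> = (\<Sum>m\<le>Suc n. of_nat (Stirling (Suc n) m) * ?f m)"
    by (subst sum.atMost_Suc_shift) simp
  finally show ?case by (simp only: mult.assoc)
qed

lemma gen_Stirling2_sum_gbinomial:
  "(\<Sum>m\<le>n. gen_Stirling2 n m x * fact m * (y gchoose m)) = (y + x) ^ n"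
proof -
  \<comment> \<open>The added indices have \<open>n - i < m\<close>, where the Stirling number
    vanishes. The range no longer depends on \<open>m\<close>, so the two sums can be swapped; the
    inner one is then \<open>y ^ (n - i)\<close>.\<close>
  have ext: "gen_Stirling2 n m x
          = (\<Sum>i\<le>n. real (n choose i) * real (Stirling (n - i) m) * x ^ i)" for m
    unfolding gen_Stirling2_def by (rule sum.mono_neutral_left) auto
  have "(\<Sum>m\<le>n. gen_Stirling2 n m x * fact m * (y gchoose m))
     = (\<Sum>m\<le>n. \<Sum>i\<le>n. real (n choose i) * x ^ i
                        * (real (Stirling (n - i) m) * fact m * (y gchoose m)))"
    by (simp add: ext sum_distrib_left sum_distrib_right algebra_simps)
  also have "\<dots> = (\<Sum>i\<le>n. real (n choose i) * x ^ i
                        * (\<Sum>m\<le>n. real (Stirling (n - i) m) * fact m * (y gchoose m)))"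
    by (subst sum.swap) (simp add: sum_distrib_left)
  also have "\<dots> = (\<Sum>i\<le>n. real (n choose i) * x ^ i * y ^ (n - i))"
  proof (intro sum.cong refl)
    fix i assume "i \<in> {..n}"
    have "(\<Sum>m\<le>n. real (Stirling (n - i) m) * fact m * (y gchoose m))
        = (\<Sum>m\<le>n - i. real (Stirling (n - i) m) * fact m * (y gchoose m))"
      by (rule sum.mono_neutral_right) auto
    then show "real (n choose i) * x ^ i
                  * (\<Sum>m\<le>n. real (Stirling (n - i) m) * fact m * (y gchoose m))
             = real (n choose i) * x ^ i * y ^ (n - i)"
      by (simp add: Stirling_sum_gbinomial)
  qed
  also have "\<dots> = (y + x) ^ n"
    by (subst add.commute) (simp add: binomial_ring)
  finally show ?thesis .
qed

text \<open>Cancelling \<open>fps_exp 1 - 1\<close> shows that the generating function at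
  \<open>x\<close> is the one at \<open>0\<close> times \<open>fps_exp x\<close>. The expansion
  exhibits a polynomial in \<open>x\<close>.\<close>

lemma bernoulli_poly_altdef:
  "bernoulli_poly n x = (\<Sum>k\<le>n. real (n choose k) * bernoulli_poly k 0 * x ^ (n - k))"
proof -
  let ?B = "\<lambda>x. Abs_fps (\<lambda>n. bernoulli_poly n x / fact n)"
  have "(?B 0 * fps_exp x) * (fps_exp 1 - 1) = ?B x * (fps_exp 1 - 1)"
    using bernoulli_poly_egf [of 0] bernoulli_poly_egf [of x] by (simp add: algebra_simps)
  moreover have "fps_exp 1 - 1 \<noteq> (0 :: real fps)"
    by (auto simp: fps_eq_iff intro!: exI [of _ 1])
  ultimately have eq: "?B 0 * fps_exp x = ?B x"
    by simp
  have "bernoulli_poly n x = fact n * fps_nth (?B 0 * fps_exp x) n"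
    unfolding eq by simp
  also have "\<dots> = (\<Sum>k\<le>n. real (n choose k) * bernoulli_poly k 0 * x ^ (n - k))"
    unfolding fps_mult_nth atLeast0AtMost sum_distrib_left
    by (intro sum.cong refl) (simp add: binomial_fact field_simps)
  finally show ?thesis .
qed

text \<open>Passing from \<open>x\<close> to \<open>x + 1\<close> changes the numerator of the
  generating function by \<open>fps_X * fps_exp x * (fps_exp 1 - 1)\<close>, so the denominator
  cancels.\<close>

lemma bernoulli_poly_diff:
  "bernoulli_poly (Suc n) (x + 1) - bernoulli_poly (Suc n) x = real (Suc n) * x ^ n"
proof -
  let ?B = "\<lambda>x. Abs_fps (\<lambda>n. bernoulli_poly n x / fact n)"
  have "(?B (x + 1) - ?B x) * (fps_exp 1 - 1) = fps_X * fps_exp x * (fps_exp 1 - 1)"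
    using bernoulli_poly_egf [of x] bernoulli_poly_egf [of "x + 1"]
    by (simp add: algebra_simps fps_exp_add_mult)
  moreover have "fps_exp 1 - 1 \<noteq> (0 :: real fps)"
    by (auto simp: fps_eq_iff intro!: exI [of _ 1])
  ultimately have eq: "?B (x + 1) - ?B x = fps_X * fps_exp x"
    by simp
  have "bernoulli_poly (Suc n) (x + 1) - bernoulli_poly (Suc n) x
      = fact (Suc n) * fps_nth (?B (x + 1) - ?B x) (Suc n)"
    by (simp add: right_diff_distrib del: fact_Suc)
  also have "\<dots> = real (Suc n) * x ^ n"
    unfolding eq by simp
  finally show ?thesis .
qed

lemma bernoulli_poly_has_real_derivative:
  "(bernoulli_poly (Suc n) has_real_derivative real (Suc n) * bernoulli_poly n x) (at x within A)"
proof -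
  have "((\<lambda>x. \<Sum>k\<le>Suc n. real (Suc n choose k) * bernoulli_poly k 0 * x ^ (Suc n - k))
      has_real_derivative (\<Sum>k\<le>Suc n. real (Suc n choose k) * bernoulli_poly k 0
          * (real (Suc n - k) * x ^ (n - k)))) (at x within A)"
    by (auto intro!: derivative_eq_intros sum.cong)
  also have "(\<Sum>k\<le>Suc n. real (Suc n choose k) * bernoulli_poly k 0
                * (real (Suc n - k) * x ^ (n - k)))
      = (\<Sum>k\<le>n. real (Suc n) * (real (n choose k) * bernoulli_poly k 0 * x ^ (n - k)))"
  proof -
    \<comment> \<open>Absorption identity; the term \<open>k = Suc n\<close> of the derivative drops
      out through its factor \<open>Suc n - k = 0\<close>.\<close>
    have "real (Suc n - k) * real (Suc n choose k) = real (Suc n) * real (n choose k)" for k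
      using binomial_absorb_comp [of "Suc n" k] by (metis diff_Suc_1 of_nat_mult)
    then have "real (Suc n choose k) * bernoulli_poly k 0 * (real (Suc n - k) * x ^ (n - k))
        = real (Suc n) * (real (n choose k) * bernoulli_poly k 0 * x ^ (n - k))" for k
      by (metis (no_types, opaque_lifting) mult.assoc mult.commute mult.left_commute)
    then show ?thesis
      by (simp only: sum.atMost_Suc) simp
  qed
  also have "\<dots> = real (Suc n) * bernoulli_poly n x"
    by (simp only: bernoulli_poly_altdef [of n x] sum_distrib_left)
  finally show ?thesis
    by (simp only: bernoulli_poly_altdef [of "Suc n", abs_def])
qed

text \<open>An antiderivative is \<open>bernoulli_poly (Suc n)\<close> divided by
  \<open>Suc n\<close>, and over an interval of length 1 its increment is given by the difference
  equation.\<close>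

lemma bernoulli_poly_has_integral:
  "(bernoulli_poly n has_integral a ^ n) {a..a + 1}"
proof -
  have "((\<lambda>x. bernoulli_poly (Suc n) x / real (Suc n)) has_real_derivative
          real (Suc n) * bernoulli_poly n x / real (Suc n)) (at x within {a..a + 1})" for x
    by (rule DERIV_cdivide [OF bernoulli_poly_has_real_derivative])
  then have "((\<lambda>x. bernoulli_poly (Suc n) x / real (Suc n)) has_vector_derivative
          bernoulli_poly n x) (at x within {a..a + 1})" for x
    unfolding has_real_derivative_iff_has_vector_derivative [symmetric] by simp
  from fundamental_theorem_of_calculus [OF _ this]
  have "(bernoulli_poly n has_integral
          (bernoulli_poly (Suc n) (a + 1) - bernoulli_poly (Suc n) a) / real (Suc n)) {a..a + 1}"
    by (simp only: diff_divide_distrib le_add_same_cancel1 zero_le_one)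
  then show ?thesis
    by (simp add: bernoulli_poly_diff)
qed

lemma poly_gbinomial_ex:
  "\<exists>p :: 'a :: field_char_0 poly. \<forall>z. poly p z = z gchoose k"
  by (rule exI [of _ "smult (1 / fact k) (\<Prod>i<k. [:- of_nat i, 1:])"])
     (simp add: gbinomial_prod_rev poly_prod lessThan_atLeast0)

text \<open>With \<open>m = Suc k\<close>, \<open>fact k * (z gchoose Suc k)\<close> is
  \<open>(z)\<^sub>m / m\<close>. Equal forward differences and the common value 0 at
  \<open>z = 0\<close> give agreement at all naturals, hence as polynomials.\<close>

lemma sum_gbinomial_gen_Stirling2:
  "(\<Sum>k\<le>n. fact k * (z gchoose Suc k) * gen_Stirling2 n k x)
     = (bernoulli_poly (Suc n) (z + x) - bernoulli_poly (Suc n) x) / real (Suc n)"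
proof -
  let ?P = "\<lambda>z. \<Sum>k\<le>n. fact k * (z gchoose Suc k) * gen_Stirling2 n k x"
  let ?Q = "\<lambda>z. (bernoulli_poly (Suc n) (z + x) - bernoulli_poly (Suc n) x) / real (Suc n)"
  obtain g :: "nat \<Rightarrow> real poly" where g: "\<And>k z. poly (g k) z = z gchoose k"
    using poly_gbinomial_ex by metis
  \<comment> \<open>Both sides become objects of type \<open>poly\<close>, so that finiteness of
    roots applies; \<open>[:x, 1:]\<close> encodes the shifted argument
    \<open>z + x\<close>.\<close>
  define p where "p = (\<Sum>k\<le>n. smult (fact k * gen_Stirling2 n k x) (g (Suc k)))"
  define b where "b = (\<Sum>k\<le>Suc n. smult (real (Suc n choose k) * bernoulli_poly k 0)
                                        ([:x, 1:] ^ (Suc n - k)))"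
  define q where "q = smult (1 / real (Suc n)) (b - [:bernoulli_poly (Suc n) x:])"
  have p: "poly p z = ?P z" for z
    by (simp add: p_def poly_sum g algebra_simps)
  have "poly b z = bernoulli_poly (Suc n) (z + x)" for z
    by (simp only: b_def bernoulli_poly_altdef [of "Suc n" "z + x"] poly_sum poly_smult poly_power)
       (simp add: add.commute)
  then have q: "poly q z = ?Q z" for z
    by (simp add: q_def)
  have "poly p (real j) = poly q (real j)" for j
  proof (induction j)
    case 0
    then show ?case by (simp add: p q)
  next
    case (Suc j)
    \<comment> \<open>By Pascal's rule the difference of \<open>z gchoose Suc k\<close> is
      \<open>z gchoose k\<close>.\<close>
    have "?P (real j + 1) - ?P (real j) = (\<Sum>k\<le>n. gen_Stirling2 n k x * fact k * (real j gchoose k))"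
      unfolding sum_subtractf [symmetric]
      by (simp only: gbinomial_Suc_Suc) (simp add: algebra_simps)
    also have "\<dots> = (real j + x) ^ n"
      by (rule gen_Stirling2_sum_gbinomial)
    also have "\<dots> = ?Q (real j + 1) - ?Q (real j)"
    proof -
      have "?Q (real j + 1) - ?Q (real j)
          = (bernoulli_poly (Suc n) (real j + x + 1) - bernoulli_poly (Suc n) (real j + x))
              / real (Suc n)"
        by (simp add: diff_divide_distrib add_ac)
      then show ?thesis
        by (simp only: bernoulli_poly_diff) simp
    qed
    finally have "poly p (real j + 1) - poly p (real j) = poly q (real j + 1) - poly q (real j)"
      by (simp only: p q)
    with Suc.IH show ?case by (simp add: add.commute)
  qed
  then have "range real \<subseteq> {z. poly (p - q) z = 0}"
    by auto
  moreover have "infinite (range real)"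
    by (simp add: range_inj_infinite inj_of_nat)
  ultimately have "p = q"
    using poly_roots_finite [of "p - q"] finite_subset by auto
  then show ?thesis
    using p q by metis
qed

text \<open>Integrates the preceding identity at \<open>z = f t\<close>; a general \<open>f\<close>
  serves both kinds of Cauchy polynomials.\<close>

lemma integral_sum_gen_Stirling2:
  fixes f :: "real \<Rightarrow> real"
  assumes "continuous_on {0..1} f"
  shows "(\<Sum>m=1..Suc n. fact m * integral {0..1} (\<lambda>t. f t gchoose m) / real m
             * gen_Stirling2 n (m - 1) x)
       = integral {0..1} (\<lambda>t. bernoulli_poly (Suc n) (f t + x) - bernoulli_poly (Suc n) x)
           / real (Suc n)"
proof -
  have integrable: "(\<lambda>t. f t gchoose k) integrable_on {0..1}" for k
    unfolding gbinomial_prod_rev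
    by (intro integrable_continuous_real continuous_intros assms) auto
  have "(\<Sum>m=1..Suc n. fact m * integral {0..1} (\<lambda>t. f t gchoose m) / real m
             * gen_Stirling2 n (m - 1) x)
      = (\<Sum>k\<le>n. integral {0..1} (\<lambda>t. fact k * (f t gchoose Suc k) * gen_Stirling2 n k x))"
    unfolding One_nat_def sum.shift_bounds_cl_Suc_ivl atLeast0AtMost
    by (intro sum.cong refl) (simp add: field_simps)
  also have "\<dots> = integral {0..1} (\<lambda>t. \<Sum>k\<le>n. fact k * (f t gchoose Suc k) * gen_Stirling2 n k x)"
    by (intro integral_sum [symmetric] integrable_on_mult_left integrable_on_mult_right integrable)
       simp
  also have "\<dots> = integral {0..1}
      (\<lambda>t. (bernoulli_poly (Suc n) (f t + x) - bernoulli_poly (Suc n) x) / real (Suc n))"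
    by (simp only: sum_gbinomial_gen_Stirling2)
  finally show ?thesis by simp
qed

theorem theorem7:
  fixes n :: nat and x :: real
  assumes "n \<ge> 1"
  shows "- (bernoulli_poly n x / real n) =
           (\<Sum>m=1..n. cauchy_poly1 m x / real m * gen_Stirling2 (n - 1) (m - 1) x) \<and>
         ((-1) ^ n - bernoulli_poly n x) / real n =
           (\<Sum>m=1..n. cauchy_poly2 m (- x) / real m * gen_Stirling2 (n - 1) (m - 1) x)"
proof -
  obtain N where n: "n = Suc N"
    using assms by (cases n) auto
  have const: "((\<lambda>t::real. bernoulli_poly n x) has_integral bernoulli_poly n x) {0..1}"
    using has_integral_const_real [of "bernoulli_poly n x" 0 1] by simp
  \<comment> \<open>The value is \<open>0 ^ n\<close>, which is 0 because \<open>n\<close> is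
    positive.\<close>
  have "(bernoulli_poly n has_integral 0) {0..1}"
    using bernoulli_poly_has_integral [of n 0] by (simp add: n)
  from has_integral_diff [OF this const]
  have 1: "integral {0..1} (\<lambda>t. bernoulli_poly n t - bernoulli_poly n x) = - bernoulli_poly n x"
    by (simp add: integral_unique)
  \<comment> \<open>Reflection carries the unit interval to \<open>{-1..0}\<close>, where the
    integral is that for \<open>a = -1\<close>.\<close>
  have "((\<lambda>t. bernoulli_poly n (- t)) has_integral (-1) ^ n) {0..1}"
    using bernoulli_poly_has_integral [of n "-1"]
      has_integral_reflect_real [of "bernoulli_poly n" "(-1) ^ n" 0 "-1"] by simp
  from has_integral_diff [OF this const]
  have 2: "integral {0..1} (\<lambda>t. bernoulli_poly n (- t) - bernoulli_poly n x)
             = (-1) ^ n - bernoulli_poly n x"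
    by (simp add: integral_unique)
  \<comment> \<open>For these two choices of \<open>f\<close>, \<open>f t + x\<close> is
    \<open>t\<close> and \<open>- t\<close>, matching the integrals just computed.\<close>
  have cont: "continuous_on {0..1} (\<lambda>t. t - x)" "continuous_on {0..1} (\<lambda>t. - x - t)"
    by (auto intro!: continuous_intros)
  show ?thesis
    using integral_sum_gen_Stirling2 [OF cont(1), of N x]
      integral_sum_gen_Stirling2 [OF cont(2), of N x] 1 2
    by (simp add: n cauchy_poly1_def cauchy_poly2_def)
qed

end
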